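(* There are absolute constants $C_1,C_2>0$ such that the following is true. Let $\{M_t\}_{t=0,1,2,\dots}$ be a Rademacher random walk. Let $\delta>0$ and let $T$ be a finite time (a positive integer) such that $T > C_2\log\left(\frac{2}{\delta}\right)$ and $\delta\in\left[\frac{4}{\log((T-1)/3)},\,\frac{1}{C_1}\right]$. Then with probability at most $1-\delta$, for all integers $t\in\left[C_2\log\left(\frac{2}{\delta}\right),T\right)$ simultaneously, both $$|M_t|\le \frac{2}{3e^2}\,t \qquad\text{and}\qquad |M_t| \le \sqrt{\frac{2}{3}t\left(\log\log\left(\frac{\frac{2}{3}t}{|M_t|+2\sqrt{t/3}}\right)+\log\left(\frac{1}{C_1\delta}\right)\right)}$$ hold. It suffices to take $C_1=\left(\frac{420}{11}\right)^2$ and $C_2=164$.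
   Context: A Rademacher random walk is the process $M_0=0$, $M_t=\sum_{i=1}^t\sigma_i$, where $\sigma_1,\sigma_2,\dots$ are i.i.d. with $\Pr(\sigma_i=-1)=\Pr(\sigma_i=+1)=1/2$. Logarithms are natural. The event whose probability is bounded is that at every $t$ in the interval both inequalities hold (the second is only considered when the first holds). *)

theory Defs
  imports "HOL-Probability.Probability"
begin

locale rademacher_walk = prob_space M for M :: "'a measure" +
  fixes \<sigma> :: "nat \<Rightarrow> 'a \<Rightarrow> real"
  assumes indep_steps: "indep_vars (\<lambda>_. borel) \<sigma> {1..}"
    and step_plus: "\<And>i. i \<ge> 1 \<Longrightarrow> prob {\<omega> \<in> space M. \<sigma> i \<omega> = 1} = 1 / 2"
    and step_minus: "\<And>i. i \<ge> 1 \<Longrightarrow> prob {\<omega> \<in> space M. \<sigma> i \<omega> = - 1} = 1 / 2"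

definition walk :: "(nat \<Rightarrow> 'a \<Rightarrow> real) \<Rightarrow> nat \<Rightarrow> 'a \<Rightarrow> real" where
  "walk \<sigma> t \<omega> = (\<Sum>i=1..t. \<sigma> i \<omega>)"

definition within_lil_bounds :: "real \<Rightarrow> real \<Rightarrow> nat \<Rightarrow> real \<Rightarrow> bool" where
  "within_lil_bounds C1 \<delta> t m \<longleftrightarrow>
     \<bar>m\<bar> \<le> 2 / (3 * (exp 1)\<^sup>2) * real t \<and>
     \<bar>m\<bar> \<le> sqrt (2 / 3 * real t *
            (ln (ln ((2 / 3 * real t) / (\<bar>m\<bar> + 2 * sqrt (real t / 3)))) + ln (1 / (C1 * \<delta>))))"

(* The itself argument records the type of the sample spaces quantified over.
   For C1 = (420/11)^2 and C2 = 164 the hypotheses force T > 1300 and t > 1300, and the first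
   inequality of within_lil_bounds then makes the arguments of both nested logarithms exceed 1
   (and C1 * \<delta> <= 1), so where the second inequality matters no logarithm, quotient or
   square root is used outside its mathematical domain. *)
definition lil_anticoncentration :: "'a itself \<Rightarrow> real \<Rightarrow> real \<Rightarrow> bool" where
  "lil_anticoncentration (_ :: 'a itself) C1 C2 \<longleftrightarrow>
     (\<forall>(M :: 'a measure) \<sigma> (\<delta> :: real) (T :: nat).
        rademacher_walk M \<sigma> \<longrightarrow> \<delta> > 0 \<longrightarrow> T > 0 \<longrightarrow> real T > C2 * ln (2 / \<delta>) \<longrightarrow>
        \<delta> \<in> {4 / ln ((real T - 1) / 3) .. 1 / C1} \<longrightarrow>
        measure M {\<omega> \<in> space M. \<forall>t :: nat. real t \<in> {C2 * ln (2 / \<delta>) ..< real T} \<longrightarrow>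
                      within_lil_bounds C1 \<delta> t (walk \<sigma> t \<omega>)} \<le> 1 - \<delta>)"

end

theory Submission imports Defs
begin

text \<open>
  A single time suffices. Put \<open>l = ln (2 / \<delta>)\<close>, \<open>t = 2 * n\<close> with \<open>n = \<lceil>82 * l\<rceil>\<close>, and
  \<open>k = \<lceil>11 / 2 * l\<rceil>\<close>. The value \<open>2 * k\<close> exceeds the iterated-logarithm boundary at time \<open>t\<close>,
  because there the expression below the square root is at most \<open>2 / 3 * t * (11 / 10 * l)\<close>.
  On the other hand \<open>\<bar>M\<^sub>t\<bar> = 2 * k\<close> has probability \<open>2 * (2 * n choose (n + k)) / 4 ^ n\<close>, which is at least
  \<open>exp (- k\<^sup>2 / (n - k)) / sqrt n \<ge> exp (- 9 / 20 * l) / sqrt n \<ge> \<delta>\<close>.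
\<close>

section \<open>Lower bounds for binomial coefficients near the centre\<close>

text \<open>Induction on the squared inequality, which avoids roots. Consecutive central
  coefficients have ratio \<open>2 * (2 * n + 1) / (n + 1)\<close>, so the step reduces to
  \<open>4 * n * (n + 1) \<le> (2 * n + 1)\<^sup>2\<close>.\<close>

lemma central_binomial_ge_sqrt:
  assumes "n > 0"
  shows "4 ^ n / (2 * sqrt (real n)) \<le> real (2 * n choose n)"
proof -
  \<comment> \<open>Indexing by \<open>Suc m\<close> starts the induction at 1, where equality
    holds; at 0 the inequality would fail.\<close>
  have "16 ^ Suc m \<le> 4 * real (Suc m) * (real (2 * Suc m choose Suc m))\<^sup>2" for m
  proof (induction m)
    case 0
    show ?case by (simp add: numeral_2_eq_2)
  next
    case (Suc m)
    define n where "n = Suc m"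
    define c where "c = real (2 * n choose n)"
    define d where "d = real (2 * Suc n choose Suc n)"
    have "Suc n * (2 * Suc n choose Suc n) = 2 * Suc n * (Suc (2 * n) choose n)"
      using Suc_times_binomial_eq[of "Suc (2 * n)" n] by (simp add: mult.commute)
    hence d1: "d = 2 * real (Suc (2 * n) choose n)"
      unfolding d_def
      by (metis (no_types, opaque_lifting) mult.assoc mult.left_commute mult_cancel1 nat.distinct(1) of_nat_mult of_nat_numeral)
    have "Suc n * (Suc (2 * n) choose Suc n) = Suc (2 * n) * (2 * n choose n)"
      using Suc_times_binomial_eq[of "2 * n" n] by (simp add: mult.commute)
    moreover have "Suc (2 * n) choose Suc n = Suc (2 * n) choose n"
      using binomial_symmetric[of n "Suc (2 * n)"] by simp
    ultimately have "real (Suc n) * real (Suc (2 * n) choose n) = real (Suc (2 * n)) * c"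
      unfolding c_def by (metis of_nat_mult)
    hence d: "(real n + 1) * d = 2 * (2 * real n + 1) * c"
      using d1 by (simp add: algebra_simps)
    have IH: "16 ^ n \<le> 4 * real n * c\<^sup>2"
      using Suc.IH by (simp add: n_def c_def)
    have "(real n + 1) * 16 ^ Suc n \<le> (real n + 1) * (16 * (4 * real n * c\<^sup>2))"
      using IH by (intro mult_left_mono) auto
    also have "\<dots> = 4 * (4 * (real n * (real n + 1) * 4)) * c\<^sup>2"
      by (simp add: algebra_simps)
    also have "\<dots> \<le> 4 * (4 * (2 * real n + 1)\<^sup>2) * c\<^sup>2"
      by (intro mult_right_mono mult_left_mono) (auto simp: power2_eq_square algebra_simps)
    also have "\<dots> = 4 * ((real n + 1) * d)\<^sup>2"
      unfolding d by (simp add: power2_eq_square algebra_simps)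
    also have "\<dots> = (real n + 1) * (4 * (real n + 1) * d\<^sup>2)"
      by (simp add: power2_eq_square algebra_simps)
    finally have "16 ^ Suc n \<le> 4 * (real n + 1) * d\<^sup>2"
      by (subst (asm) mult_le_cancel_left_pos) auto
    thus ?case by (simp add: n_def d_def add.commute)
  qed
  from this[of "n - 1"] assms have "16 ^ n \<le> 4 * real n * (real (2 * n choose n))\<^sup>2"
    by simp
  also have "\<dots> = (2 * sqrt (real n) * real (2 * n choose n))\<^sup>2"
    by (simp add: power_mult_distrib)
  finally have "(4 ^ n)\<^sup>2 \<le> (2 * sqrt (real n) * real (2 * n choose n))\<^sup>2"
    by (simp flip: power_mult add: mult.commute[of n] power_mult)
  hence "4 ^ n \<le> 2 * sqrt (real n) * real (2 * n choose n)"
    by (rule power2_le_imp_le) simp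
  thus ?thesis
    using assms by (simp add: field_simps)
qed

text \<open>Moving from \<open>n + i\<close> to \<open>n + i + 1\<close> multiplies the coefficient
  by \<open>(n - i) / (n + i + 1) = 1 / (1 + y)\<close> with
  \<open>y = (2 * i + 1) / (n - i)\<close>, and \<open>1 + y \<le> exp y\<close>. The odd numbers
  \<open>2 * i + 1\<close> for \<open>i < k\<close> sum to \<open>k\<^sup>2\<close>.\<close>

lemma binomial_ge_central_binomial_exp:
  assumes "k < n"
  shows "real (2 * n choose n) * exp (- (real k)\<^sup>2 / (real n - real k)) \<le> real (2 * n choose (n + k))"
proof -
  have "real (2 * n choose n) * exp (- (real i)\<^sup>2 / (real n - real k)) \<le> real (2 * n choose (n + i))"
    if "i \<le> k" for i
    using that
  proof (induction i)
    case 0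
    show ?case by simp
  next
    case (Suc i)
    \<comment> \<open>Fixing the smallest denominator \<open>n - k\<close> for all \<open>i\<close>
      lets the exponents add up exactly.\<close>
    define q where "q = real n - real k"
    have q: "q > 0" "q \<le> real n - real i"
      using assms Suc.prems by (auto simp: q_def)
    define y where "y = (2 * real i + 1) / (real n - real i)"
    have "1 + y = (real n + real i + 1) / (real n - real i)"
      using q by (simp add: y_def field_simps)
    moreover have "1 + y \<le> exp y" by (rule exp_ge_add_one_self)
    moreover have "y \<le> (2 * real i + 1) / q"
      unfolding y_def using q by (intro divide_left_mono) auto
    ultimately have le: "(real n + real i + 1) / (real n - real i) \<le> exp ((2 * real i + 1) / q)"
      using exp_le_cancel_iff[of y "(2 * real i + 1) / q"] by linarith
    have step: "(real n + real i + 1) * exp (- ((2 * real i + 1) / q)) \<le> real n - real i"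
    proof -
      define z where "z = (2 * real i + 1) / q"
      from le have "real n + real i + 1 \<le> exp z * (real n - real i)"
        using q by (simp add: z_def divide_le_eq)
      hence "(real n + real i + 1) * exp (- z) \<le> real n - real i"
        by (simp add: exp_minus divide_simps mult.commute)
      thus ?thesis by (simp add: z_def)
    qed
    have "(real n + real i + 1) * (real (2 * n choose n) * exp (- (real (Suc i))\<^sup>2 / q))
        = real (2 * n choose n) * exp (- (real i)\<^sup>2 / q) * ((real n + real i + 1) * exp (- ((2 * real i + 1) / q)))"
      by (simp add: exp_add[symmetric] power2_eq_square diff_divide_distrib add_divide_distrib algebra_simps)
    also have "\<dots> \<le> real (2 * n choose (n + i)) * (real n - real i)"
      using Suc step by (intro mult_mono) (auto simp: q_def)
    also have "\<dots> = (real n + real i + 1) * real (2 * n choose (n + Suc i))"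
    proof -
      have "Suc (n + i) * (2 * n choose Suc (n + i)) = (2 * n - (n + i)) * (2 * n choose (n + i))"
        by (metis binomial_absorb_comp binomial_absorption mult.commute)
      hence "real (Suc (n + i)) * real (2 * n choose Suc (n + i)) = real (n - i) * real (2 * n choose (n + i))"
        by (metis diff_cancel2 add.commute add_diff_cancel_left mult_2 of_nat_mult)
      thus ?thesis
        using Suc.prems assms by (simp add: of_nat_diff algebra_simps)
    qed
    finally show ?case
      by (subst (asm) mult_le_cancel_left_pos) (auto simp: q_def)
  qed
  thus ?thesis by blast
qed

section \<open>Point probabilities of the walk\<close>

context rademacher_walk
begin

lemma random_variable_step: "i \<ge> 1 \<Longrightarrow> random_variable borel (\<sigma> i)"
  using indep_steps by (auto simp: indep_vars_def)

lemma random_variable_walk: "random_variable borel (walk \<sigma> t)"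
  unfolding walk_def using random_variable_step by (intro borel_measurable_sum) auto

lemma prob_walk_step:
  "prob {\<omega> \<in> space M. walk \<sigma> t \<omega> = x \<and> \<sigma> (Suc t) \<omega> = s}
    = prob {\<omega> \<in> space M. walk \<sigma> t \<omega> = x} * prob {\<omega> \<in> space M. \<sigma> (Suc t) \<omega> = s}"
proof -
  have "indep_vars (\<lambda>_. borel) \<sigma> (insert (Suc t) {1..t})"
    using indep_steps by (rule indep_vars_subset) auto
  hence "indep_var borel (\<sigma> (Suc t)) borel (walk \<sigma> t)"
    unfolding walk_def[abs_def] by (intro indep_vars_sum) auto
  from indep_varD[OF this, of "{s}" "{x}"] show ?thesis
    by (simp add: vimage_def Int_def conj_commute mult.commute)
qed

text \<open>Pascal's rule, split by the last step. The bound is one-sided because the locale fixes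
  the step values only almost surely: the paths through \<open>up\<close> and \<open>down\<close>
  are contained in the event but need not exhaust it.\<close>

lemma prob_walk_ge_binomial:
  "real (t choose j) / 2 ^ t \<le> prob {\<omega> \<in> space M. walk \<sigma> t \<omega> = 2 * real j - real t}"
proof (induction t arbitrary: j)
  case 0
  show ?case by (cases j) (auto simp: walk_def prob_space)
next
  case (Suc t)
  note [measurable] = random_variable_walk random_variable_step[of "Suc t", simplified]
  define down where "down = {\<omega> \<in> space M. walk \<sigma> t \<omega> = 2 * real j - real t \<and> \<sigma> (Suc t) \<omega> = -1}"
  have down: "real (t choose j) / 2 ^ t / 2 \<le> prob down"
    unfolding down_def prob_walk_step using Suc.IH[of j] by (subst step_minus) auto
  show ?case
  proof (cases j)
    case 0
    have "prob down \<le> prob {\<omega> \<in> space M. walk \<sigma> (Suc t) \<omega> = 2 * real j - real (Suc t)}"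
      by (intro finite_measure_mono, force simp: down_def walk_def, measurable)
    with down show ?thesis by (simp add: 0)
  next
    case (Suc i)
    define up where "up = {\<omega> \<in> space M. walk \<sigma> t \<omega> = 2 * real i - real t \<and> \<sigma> (Suc t) \<omega> = 1}"
    have "real (t choose i) / 2 ^ t / 2 \<le> prob up"
      unfolding up_def prob_walk_step using Suc.IH[of i] by (subst step_plus) auto
    hence "real (Suc t choose j) / 2 ^ Suc t \<le> prob up + prob down"
      using down by (simp add: Suc field_simps)
    also have "\<dots> = prob (up \<union> down)"
      by (intro finite_measure_Union[symmetric]) (auto simp: up_def down_def)
    also have "\<dots> \<le> prob {\<omega> \<in> space M. walk \<sigma> (Suc t) \<omega> = 2 * real j - real (Suc t)}"
      by (intro finite_measure_mono, force simp: up_def down_def walk_def Suc, measurable)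
    finally show ?thesis .
  qed
qed

text \<open>The endpoints \<open>2 * k\<close> and \<open>- 2 * k\<close> are distinct and have
  equal binomial weights; adding both cancels the 2 in the denominator of the central binomial
  bound.\<close>

lemma prob_abs_walk_ge:
  assumes "0 < k" "k < n"
  shows "exp (- (real k)\<^sup>2 / (real n - real k)) / sqrt (real n)
    \<le> prob {\<omega> \<in> space M. \<bar>walk \<sigma> (2 * n) \<omega>\<bar> = 2 * real k}"
proof -
  note [measurable] = random_variable_walk
  define A where "A x = {\<omega> \<in> space M. walk \<sigma> (2 * n) \<omega> = x}" for x
  have A: "A x \<in> events" for x unfolding A_def by measurable
  define b where "b = real (2 * n choose (n + k))"
  have up: "b / 4 ^ n \<le> prob (A (2 * real k))"
    using prob_walk_ge_binomial[of "2 * n" "n + k"] by (simp add: A_def b_def power_mult)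
  have "2 * n choose (n - k) = 2 * n choose (n + k)"
    using assms binomial_symmetric[of "n - k" "2 * n"] by (simp add: mult_2)
  hence down: "b / 4 ^ n \<le> prob (A (- 2 * real k))"
    using prob_walk_ge_binomial[of "2 * n" "n - k"] assms by (simp add: A_def b_def power_mult of_nat_diff)
  have "4 ^ n / (2 * sqrt (real n)) * exp (- (real k)\<^sup>2 / (real n - real k)) \<le> b"
    unfolding b_def
    using central_binomial_ge_sqrt[of n] binomial_ge_central_binomial_exp[of k n] assms
    by (meson exp_ge_zero less_trans mult_right_mono order_trans)
  hence "exp (- (real k)\<^sup>2 / (real n - real k)) / sqrt (real n) \<le> b / 4 ^ n + b / 4 ^ n"
    using assms by (simp add: field_simps)
  also have "\<dots> \<le> prob (A (2 * real k)) + prob (A (- 2 * real k))"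
    using up down by (rule add_mono)
  also have "\<dots> = prob (A (2 * real k) \<union> A (- 2 * real k))"
    using A assms by (intro finite_measure_Union[symmetric]) (auto simp: A_def)
  also have "\<dots> \<le> prob {\<omega> \<in> space M. \<bar>walk \<sigma> (2 * n) \<omega>\<bar> = 2 * real k}"
    by (intro finite_measure_mono) (auto simp: A_def)
  finally show ?thesis .
qed

end

section \<open>Numerical estimates at the chosen time\<close>

text \<open>If the first inequality holds, the iterated logarithm is defined and costs at most
  \<open>l / 10 + 3\<close>, while \<open>ln (1 / (C * \<delta>))\<close> is at most
  \<open>l - 4\<close>. So the second inequality would force
  \<open>\<bar>m\<bar> < 11 * l\<close>.\<close>

lemma not_within_lil_boundsI:
  fixes l \<delta> m :: real
  defines "C \<equiv> (420 / 11)\<^sup>2 :: real"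
  assumes "\<delta> > 0" and l: "l = ln (2 / \<delta>)" "l \<ge> 15 / 2"
    and n: "82 * l \<le> real n" "real n \<le> 82 * l + 1" and m: "11 * l \<le> \<bar>m\<bar>"
  shows "\<not> within_lil_bounds C \<delta> (2 * n) m"
proof
  define t where "t = real (2 * n)"
  define R where "R = (2 / 3 * t) / (\<bar>m\<bar> + 2 * sqrt (t / 3))"
  assume W: "within_lil_bounds C \<delta> (2 * n) m"
  have t: "t \<ge> 164 * l" "t \<le> 164 * l + 2" "t \<ge> 1000"
    using n l by (auto simp: t_def)
  have "2 * sqrt (t / 3) = sqrt (4 * (t / 3))"
    by (simp only: real_sqrt_mult real_sqrt_four)
  also have "\<dots> \<le> sqrt ((t / 6)\<^sup>2)"
    using t by (intro real_sqrt_le_mono) (auto simp: power2_eq_square)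
  finally have small: "2 * sqrt (t / 3) \<le> t / 6"
    using t by simp
  have pos: "2 * sqrt (t / 3) > 0" using t by simp
  \<comment> \<open>The crude bound \<open>2 \<le> exp 1\<close> turns the first inequality into
    \<open>\<bar>m\<bar> \<le> t / 6\<close>. The denominator of \<open>R\<close> is then at most
    \<open>t / 3\<close>, so \<open>R > 1\<close> and \<open>ln R\<close> is positive.\<close>
  have "(2::real) \<le> exp 1" using exp_ge_add_one_self[of 1] by simp
  hence "(4::real) \<le> (exp 1)\<^sup>2" using power_mono[of 2 "exp 1 :: real" 2] by simp
  hence "2 / (3 * (exp 1)\<^sup>2) \<le> (2 / (3 * 4) :: real)"
    by (intro divide_left_mono) auto
  hence "2 / (3 * (exp 1)\<^sup>2) * t \<le> 1 / 6 * t"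
    using t by (intro mult_right_mono) auto
  with W have "\<bar>m\<bar> \<le> t / 6"
    by (simp add: within_lil_bounds_def t_def)
  with small t have "\<bar>m\<bar> + 2 * sqrt (t / 3) < 2 / 3 * t" by linarith
  moreover have "\<bar>m\<bar> + 2 * sqrt (t / 3) > 0" using pos by linarith
  ultimately have "R > 1"
    unfolding R_def by (subst less_divide_eq_1_pos)
  have "R \<le> (2 / 3 * t) / (2 * sqrt (t / 3))"
    unfolding R_def using pos t by (intro divide_left_mono) (auto intro!: mult_pos_pos add_nonneg_pos)
  also have "\<dots> = sqrt (t / 3)"
    using t by (simp add: field_simps real_sqrt_divide)
  finally have "ln R \<le> ln (sqrt (t / 3))"
    using \<open>R > 1\<close> by (intro ln_mono) auto
  also have "\<dots> = ln (t / 3) / 2"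
    using t by (simp add: ln_sqrt)
  \<comment> \<open>The factor \<open>l / 5\<close> gives slope 1/10 after halving;
    \<open>512 = 2 ^ 9\<close> is ample for \<open>t / 3\<close> and has logarithm at most
    9.\<close>
  also have "ln (t / 3) \<le> ln (512 * (l / 5))"
    using t l by (intro ln_mono) auto
  also have "\<dots> = 9 * ln 2 + ln (l / 5)"
    using l ln_realpow[of 2 9] by (subst ln_mult) auto
  also have "\<dots> \<le> 9 * (2 - 1) + (l / 5 - 1)"
    using l by (intro add_mono mult_left_mono ln_le_minus_one) auto
  finally have "ln R \<le> l / 10 + 4" by simp
  moreover have "ln (ln R) \<le> ln R - 1"
    using \<open>R > 1\<close> by (intro ln_le_minus_one) auto
  moreover have "ln (1 / (C * \<delta>)) = l - ln (2 * C)"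
    using \<open>\<delta> > 0\<close> by (simp add: l C_def ln_div ln_mult)
  moreover have "ln (2 * C) \<ge> 4"
  proof -
    have "exp (4::real) = exp 1 ^ 4" by (simp flip: exp_of_nat_mult)
    also have "\<dots> \<le> 3 ^ 4" using exp_le by (intro power_mono) auto
    also have "\<dots> \<le> 2 * C" by (simp add: C_def power2_eq_square)
    finally show ?thesis by (subst ln_ge_iff) (auto simp: C_def)
  qed
  ultimately have bracket: "ln (ln R) + ln (1 / (C * \<delta>)) \<le> 11 / 10 * l"
    by linarith
  have "2 / 3 * t * (ln (ln R) + ln (1 / (C * \<delta>))) \<le> 2 / 3 * (164 * l + 2) * (11 / 10 * l)"
  proof -
    have "2 / 3 * t * (ln (ln R) + ln (1 / (C * \<delta>))) \<le> 2 / 3 * t * (11 / 10 * l)"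
      using bracket t by (intro mult_left_mono) auto
    also have "\<dots> \<le> 2 / 3 * (164 * l + 2) * (11 / 10 * l)"
      using t \<open>l \<ge> 15 / 2\<close> by (intro mult_right_mono) auto
    finally show ?thesis .
  qed
  \<comment> \<open>The leading coefficients are close: \<open>2 / 3 * 164 * 11 / 10\<close> is
    about 120.27, against 121. The gap 11/15 absorbs the linear term once
    \<open>l > 2\<close>.\<close>
  also have "\<dots> < (11 * l)\<^sup>2"
  proof -
    have "15 / 2 * l \<le> l * l" using l by (intro mult_right_mono) auto
    moreover have "(11 * l)\<^sup>2 - 2 / 3 * (164 * l + 2) * (11 / 10 * l) = 11 / 15 * (l * l) - 22 / 15 * l"
      by (simp add: power2_eq_square algebra_simps)
    ultimately show ?thesis using l(2) by linarith
  qed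
  finally have "sqrt (2 / 3 * t * (ln (ln R) + ln (1 / (C * \<delta>)))) < sqrt ((11 * l)\<^sup>2)"
    by (rule real_sqrt_less_mono)
  moreover have "sqrt ((11 * l)\<^sup>2) = 11 * l"
    using l(2) by (intro real_sqrt_unique) auto
  ultimately have "sqrt (2 / 3 * t * (ln (ln R) + ln (1 / (C * \<delta>)))) < \<bar>m\<bar>"
    using m by linarith
  with W show False
    by (simp add: within_lil_bounds_def t_def R_def)
qed

text \<open>The left side is \<open>\<delta>\<close> when \<open>l = ln (2 / \<delta>)\<close>. The
  Gaussian-type factor costs at most \<open>9 / 20 * l\<close> in the exponent; the remaining
  \<open>11 / 20 * l\<close> pays for \<open>2 * sqrt n\<close>.\<close>

lemma exp_neg_le_point_probability_bound:
  fixes l :: real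
  assumes l: "l \<ge> 15 / 2" and n: "82 * l \<le> real n" "real n \<le> 82 * l + 1"
    and k: "11 / 2 * l \<le> real k" "real k \<le> 11 / 2 * l + 1"
  shows "2 * exp (- l) \<le> exp (- (real k)\<^sup>2 / (real n - real k)) / sqrt (real n)"
proof -
  \<comment> \<open>Rounding is absorbed into the slopes: \<open>k \<le> 17 / 3 * l\<close> and
    \<open>n - k \<ge> 76 * l\<close>; also \<open>(17 / 3)\<^sup>2 < 9 / 20 * 76\<close>.\<close>
  have "(real k)\<^sup>2 \<le> (17 / 3 * l)\<^sup>2"
    using k l by (intro power_mono) auto
  also have "\<dots> \<le> 9 / 20 * l * (76 * l)"
    by (simp add: power2_eq_square algebra_simps)
  also have "\<dots> \<le> 9 / 20 * l * (real n - real k)"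
    using n k l by (intro mult_left_mono) auto
  finally have "(real k)\<^sup>2 / (real n - real k) \<le> 9 / 20 * l"
    using n k l by (subst divide_le_eq) auto
  hence exponent: "exp (- (9 / 20) * l) \<le> exp (- (real k)\<^sup>2 / (real n - real k))"
    by simp
  \<comment> \<open>Here \<open>4 * n \<le> 332 * l\<close>. The exponential of
    \<open>11 / 10 * l\<close> is bounded below by its tangent at 8, near the smallest argument
    8.25, with \<open>exp 8\<close> replaced by a rational lower bound.\<close>
  have "332 * l \<le> (17 / 16) ^ 128 * (1 + (l * 11 / 10 - 8))"
    using l by (simp add: field_simps)
  also have "\<dots> \<le> exp 8 * exp (l * 11 / 10 - 8)"
  proof (intro mult_mono)
    have "(17 / 16 :: real) \<le> exp (1 / 16)"
      using exp_ge_add_one_self[of "1 / 16"] by simp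
    hence "(17 / 16 :: real) ^ 128 \<le> exp (1 / 16) ^ 128" by (intro power_mono) auto
    thus "(17 / 16) ^ 128 \<le> (exp 8 :: real)" by (simp flip: exp_of_nat_mult)
    show "1 + (l * 11 / 10 - 8) \<le> exp (l * 11 / 10 - 8)" by (rule exp_ge_add_one_self)
  qed (use l in auto)
  also have "\<dots> = (exp (11 / 20 * l))\<^sup>2"
    by (simp flip: exp_add exp_double)
  finally have "332 * l \<le> (exp (11 / 20 * l))\<^sup>2" .
  hence "(2 * sqrt (real n))\<^sup>2 \<le> (exp (11 / 20 * l))\<^sup>2"
    using n l by (simp add: power_mult_distrib)
  hence "2 * sqrt (real n) \<le> exp (11 / 20 * l)"
    by (rule power2_le_imp_le) simp
  hence "exp (- l) * (2 * sqrt (real n)) \<le> exp (- l) * exp (11 / 20 * l)"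
    by (intro mult_left_mono) auto
  also have "\<dots> = exp (- (9 / 20) * l)"
    by (simp flip: exp_add)
  also note exponent
  finally show ?thesis
    using n l by (simp add: field_simps)
qed

section \<open>Combining the estimates\<close>

text \<open>The upper bound on \<open>\<delta>\<close> provides \<open>l \<ge> 15 / 2\<close> for
  the numerical estimates; the lower bound makes \<open>T\<close> so large that time
  \<open>2 * n\<close> lies in the window.\<close>

lemma lil_anticoncentration_explicit:
  "lil_anticoncentration TYPE('a) ((420 / 11)\<^sup>2) 164"
  unfolding lil_anticoncentration_def
proof (intro allI impI)
  fix M :: "'a measure" and \<sigma> :: "nat \<Rightarrow> 'a \<Rightarrow> real" and \<delta> :: real and T :: nat
  assume walk: "rademacher_walk M \<sigma>" and "\<delta> > 0" and T: "real T > 164 * ln (2 / \<delta>)"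
    and \<delta>: "\<delta> \<in> {4 / ln ((real T - 1) / 3) .. 1 / (420 / 11)\<^sup>2}"
  interpret rademacher_walk M \<sigma> by fact
  note [measurable] = random_variable_walk
  define l where "l = ln (2 / \<delta>)"
  have \<delta>_eq: "\<delta> = 2 * exp (- l)"
    using \<open>\<delta> > 0\<close> by (simp add: l_def exp_minus)
  have small: "\<delta> \<le> 1 / 1450"
    using \<delta> by (simp add: power2_eq_square)
  have l: "l \<ge> 15 / 2"
  proof -
    have "(exp (15 / 2 :: real))\<^sup>2 = exp 1 ^ 15" by (simp flip: exp_of_nat_mult exp_double)
    also have "\<dots> \<le> (14 / 5) ^ 15" using e_less_272 by (intro power_mono) auto
    also have "\<dots> \<le> 2900\<^sup>2" by (simp add: power_divide)
    finally have "exp (15 / 2 :: real) \<le> 2900" by (rule power2_le_imp_le) simp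
    also have "\<dots> \<le> 2 / \<delta>" using small \<open>\<delta> > 0\<close> by (simp add: field_simps)
    finally show ?thesis using \<open>\<delta> > 0\<close> unfolding l_def by (subst ln_ge_iff) auto
  qed
  define n where "n = nat \<lceil>82 * l\<rceil>"
  define k where "k = nat \<lceil>11 / 2 * l\<rceil>"
  have n: "82 * l \<le> real n" "real n \<le> 82 * l + 1"
    using l unfolding n_def by linarith+
  have k: "11 / 2 * l \<le> real k" "real k \<le> 11 / 2 * l + 1"
    using l unfolding k_def by linarith+
  have "real (2 * n) < real T"
  proof -
    \<comment> \<open>This makes \<open>ln ((real T - 1) / 3)\<close> positive, so the lower bound
      on \<open>\<delta>\<close> can be inverted.\<close>
    have "real T > 1000" using T l by (simp add: l_def)
    hence "4 / \<delta> \<le> ln ((real T - 1) / 3)"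
      using \<delta> \<open>\<delta> > 0\<close> by (simp add: field_simps)
    hence "exp (4 / \<delta>) \<le> (real T - 1) / 3"
      using \<open>real T > 1000\<close> by (subst (asm) ln_ge_iff) auto
    \<comment> \<open>Thus \<open>T\<close> grows at least quadratically in
      \<open>1 / \<delta>\<close>, whereas \<open>2 * n \<le> 164 * l + 2\<close> is at most linear
      in it.\<close>
    moreover have "1 + 4 / \<delta> + (4 / \<delta>)\<^sup>2 / 2 \<le> exp (4 / \<delta>)"
      using \<open>\<delta> > 0\<close> by (intro exp_lower_Taylor_quadratic) auto
    moreover have "1450 * (1 / \<delta>) \<le> (1 / \<delta>) * (1 / \<delta>)"
      using small \<open>\<delta> > 0\<close> by (intro mult_right_mono) (auto simp: field_simps)
    moreover have "l \<le> 2 / \<delta> - 1"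
      unfolding l_def using \<open>\<delta> > 0\<close> by (intro ln_le_minus_one) auto
    moreover have "1 / \<delta> > 0" using \<open>\<delta> > 0\<close> by simp
    ultimately show ?thesis
      using n by (simp add: power2_eq_square)
  qed
  moreover have "164 * l \<le> real (2 * n)" using n by simp
  ultimately have t: "real (2 * n) \<in> {164 * ln (2 / \<delta>) ..< real T}"
    by (simp add: l_def)
  define V where "V = {\<omega> \<in> space M. \<bar>walk \<sigma> (2 * n) \<omega>\<bar> = 2 * real k}"
  have V: "V \<in> events" unfolding V_def by measurable
  have "real k > 0" "real k < real n" using n k l by linarith+
  hence "\<delta> \<le> prob V"
    using exp_neg_le_point_probability_bound[OF l n k] prob_abs_walk_ge[of k n]
    by (simp add: V_def \<delta>_eq)
  moreover have "prob {\<omega> \<in> space M. \<forall>t. real t \<in> {164 * ln (2 / \<delta>) ..< real T} \<longrightarrow>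
      within_lil_bounds ((420 / 11)\<^sup>2) \<delta> t (walk \<sigma> t \<omega>)} \<le> prob (space M - V)"
  proof (rule finite_measure_mono)
    have "\<not> within_lil_bounds ((420 / 11)\<^sup>2) \<delta> (2 * n) (walk \<sigma> (2 * n) \<omega>)" if "\<omega> \<in> V" for \<omega>
      using that k by (intro not_within_lil_boundsI[OF \<open>\<delta> > 0\<close> l_def l n]) (auto simp: V_def)
    with t show "{\<omega> \<in> space M. \<forall>t. real t \<in> {164 * ln (2 / \<delta>) ..< real T} \<longrightarrow>
      within_lil_bounds ((420 / 11)\<^sup>2) \<delta> t (walk \<sigma> t \<omega>)} \<subseteq> space M - V"
      by blast
  qed (use V in auto)
  ultimately show "prob {\<omega> \<in> space M. \<forall>t. real t \<in> {164 * ln (2 / \<delta>) ..< real T} \<longrightarrow>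
      within_lil_bounds ((420 / 11)\<^sup>2) \<delta> t (walk \<sigma> t \<omega>)} \<le> 1 - \<delta>"
    using V by (simp add: prob_compl)
qed

theorem theorem3:
  "(\<exists>C1 > 0. \<exists>C2 > 0. lil_anticoncentration TYPE('a) C1 C2) \<and>
   lil_anticoncentration TYPE('a) ((420 / 11)\<^sup>2) 164"
proof
  show "\<exists>C1 > 0. \<exists>C2 > 0. lil_anticoncentration TYPE('a) C1 C2"
    by (rule exI[of _ "(420 / 11)\<^sup>2"], intro conjI, simp)
      (rule exI[of _ 164], intro conjI lil_anticoncentration_explicit, simp)
qed (rule lil_anticoncentration_explicit)

end
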